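(* Let $\mathcal{R}$ be an associative ring with unit $1\neq 0$ and let $a,x\in\mathcal{R}$. Then the following assertions are equivalent: (1) $x\in a\{1,2\}$. (2) $\varphi_{ax}=\rho_{a\mathcal{R},\,{\rm rann}(x)}$. (3) $\varphi_{xa}=\rho_{x\mathcal{R},\,{\rm rann}(a)}$. (4) ${}_{ax}\varphi=\rho_{\mathcal{R}x,\,{\rm lann}(a)}$. (5) ${}_{xa}\varphi=\rho_{\mathcal{R}a,\,{\rm lann}(x)}$.
   Context: For $a\in\mathcal{R}$: $a\{1,2\}=\{x\in\mathcal{R}: axa=a,\ xax=x\}$; $a\mathcal{R}=\{ar:r\in\mathcal{R}\}$, $\mathcal{R}a=\{ra:r\in\mathcal{R}\}$, ${\rm rann}(a)=\{r\in\mathcal{R}:ar=0\}$, ${\rm lann}(a)=\{r\in\mathcal{R}:ra=0\}$. The additive group endomorphisms $\varphi_a,{}_a\varphi:\mathcal{R}\to\mathcal{R}$ are $\varphi_a(r)=ar$ and ${}_a\varphi(r)=ra$. For additive subgroups $\mathcal{S},\mathcal{T}$ of $\mathcal{R}$, $\mathcal{R}=\mathcal{S}\oplus\mathcal{T}$ means $\mathcal{R}=\mathcal{S}+\mathcal{T}$ and $\mathcal{S}\cap\mathcal{T}=\{0\}$; in that case $\rho_{\mathcal{S},\mathcal{T}}:\mathcal{R}\to\mathcal{R}$ is the group endomorphism $\rho_{\mathcal{S},\mathcal{T}}(s+t)=s$ for $s\in\mathcal{S}$, $t\in\mathcal{T}$. Convention: whenever $\rho_{\mathcal{S},\mathcal{T}}$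 is written, it is implicitly asserted that $\mathcal{R}=\mathcal{S}\oplus\mathcal{T}$ (so a condition such as $\varphi_{ax}=\rho_{\mathcal{S},\mathcal{T}}$ means: $\mathcal{R}=\mathcal{S}\oplus\mathcal{T}$ and the two maps are equal). *)

theory Defs
  imports Main
begin

(* An associative ring with 1 \<noteq> 0 is a type of class ring_1 (not necessarily commutative). *)

definition inverses_12 :: "'a::ring_1 \<Rightarrow> 'a set"
  where "inverses_12 a = {x. a * x * a = a \<and> x * a * x = x}"

definition right_ideal_of :: "'a::ring_1 \<Rightarrow> 'a set"
  where "right_ideal_of a = {a * r | r. True}"

definition left_ideal_of :: "'a::ring_1 \<Rightarrow> 'a set"
  where "left_ideal_of a = {r * a | r. True}"

definition rann :: "'a::ring_1 \<Rightarrow> 'a set"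
  where "rann a = {r. a * r = 0}"

definition lann :: "'a::ring_1 \<Rightarrow> 'a set"
  where "lann a = {r. r * a = 0}"

definition left_mult :: "'a::ring_1 \<Rightarrow> 'a \<Rightarrow> 'a"
  where "left_mult a = (\<lambda>r. a * r)"

definition right_mult :: "'a::ring_1 \<Rightarrow> 'a \<Rightarrow> 'a"
  where "right_mult a = (\<lambda>r. r * a)"

definition direct_decomposition :: "'a::ring_1 set \<Rightarrow> 'a set \<Rightarrow> bool"
  where "direct_decomposition S T \<longleftrightarrow> {s + t | s t. s \<in> S \<and> t \<in> T} = UNIV \<and> S \<inter> T = {0}"

(* The projection onto S along T. It is meaningful only for additive subgroups S and T with
   direct_decomposition S T; see rho_add below. *)
definition rho :: "'a::ring_1 set \<Rightarrow> 'a set \<Rightarrow> 'a \<Rightarrow> 'a"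
  where "rho S T r = (THE s. s \<in> S \<and> (\<exists>t\<in>T. r = s + t))"

(* The assertion f = rho S T, under the convention that writing rho S T implicitly
   asserts that the ring is the direct sum of S and T. *)
definition equals_rho :: "('a::ring_1 \<Rightarrow> 'a) \<Rightarrow> 'a set \<Rightarrow> 'a set \<Rightarrow> bool"
  where "equals_rho f S T \<longleftrightarrow> direct_decomposition S T \<and> f = rho S T"

lemma rho_add:
  assumes dd: "direct_decomposition S T"
    and S: "\<And>u v. u \<in> S \<Longrightarrow> v \<in> S \<Longrightarrow> u - v \<in> S"
    and T: "\<And>u v. u \<in> T \<Longrightarrow> v \<in> T \<Longrightarrow> u - v \<in> T"
    and st: "s \<in> S" "t \<in> T"
  shows "rho S T (s + t) = s"
  unfolding rho_def
proof (rule the_equality)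
  show "s \<in> S \<and> (\<exists>t'\<in>T. s + t = s + t')"
    using st by blast
next
  fix s' assume "s' \<in> S \<and> (\<exists>t'\<in>T. s + t = s' + t')"
  then obtain t' where s': "s' \<in> S" and t': "t' \<in> T" and eq: "s + t = s' + t'"
    by blast
  have "s' - s = t - t'"
    using eq by (simp add: algebra_simps)
  then have "s' - s \<in> S \<inter> T"
    using S[OF s' st(1)] T[OF st(2) t'] by simp
  then have "s' - s = 0"
    using dd unfolding direct_decomposition_def by blast
  then show "s' = s"
    by simp
qed

end

theory Submission imports Defs
begin

text \<open>
  A map \<open>f\<close> is the projection onto \<open>S\<close> along \<open>T\<close> exactly when it sends every \<open>r\<close> into \<open>S\<close> with
  remainder \<open>r - f r\<close> in \<open>T\<close>, fixes \<open>S\<close> and kills \<open>T\<close> (lemma \<open>equals_rho_iff\<close>): the first two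
  conditions make \<open>r = f r + (r - f r)\<close> a decomposition, the other two force \<open>S \<inter> T = {0}\<close>.

  For \<open>f r = a * x * r\<close>, \<open>S = a\<R>\<close> and \<open>T = rann(x)\<close>, membership in \<open>S\<close> and vanishing on
  \<open>T\<close> are automatic. The two remaining conditions are the inner and the outer inverse equation:
  \<open>f\<close> fixes \<open>a\<R>\<close> iff \<open>a * x * a = a\<close>, and \<open>r - f r\<close> always lies in \<open>rann(x)\<close> iff
  \<open>x * a * x = x\<close>, in both cases by testing at the unit of the ring. Multiplication from the
  right is the mirror image, with the two equations trading places. Since \<open>x \<in> a{1,2}\<close> is
  symmetric in \<open>a\<close> and \<open>x\<close>, exchanging them in one assertion of each kind gives the other.
\<close>

text \<open>
  This replaces the definite description in the projection by conditions that can be checked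
  element by element; the values of \<open>f\<close> themselves provide the decomposition of the ring.
\<close>
lemma equals_rho_iff:
  fixes S T :: "'a::ring_1 set"
  assumes zero: "0 \<in> S" "0 \<in> T"
    and S: "\<And>u v. u \<in> S \<Longrightarrow> v \<in> S \<Longrightarrow> u - v \<in> S"
    and T: "\<And>u v. u \<in> T \<Longrightarrow> v \<in> T \<Longrightarrow> u - v \<in> T"
  shows "equals_rho f S T \<longleftrightarrow>
    (\<forall>r. f r \<in> S) \<and> (\<forall>r. r - f r \<in> T) \<and> (\<forall>s\<in>S. f s = s) \<and> (\<forall>t\<in>T. f t = 0)"
    (is "_ \<longleftrightarrow> ?C")
proof
  assume "equals_rho f S T"
  then have dd: "direct_decomposition S T" and f: "f = rho S T"
    by (simp_all add: equals_rho_def)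
  have f_add: "f (s + t) = s" if "s \<in> S" "t \<in> T" for s t
    unfolding f by (rule rho_add[OF dd S T that])
  have "f r \<in> S \<and> r - f r \<in> T" for r
  proof -
    have "r \<in> {s + t | s t. s \<in> S \<and> t \<in> T}"
      using dd by (simp add: direct_decomposition_def)
    then obtain s t where "r = s + t" "s \<in> S" "t \<in> T" by blast
    then show ?thesis by (simp add: f_add)
  qed
  moreover have "f s = s" if "s \<in> S" for s
    using f_add[OF that zero(2)] by simp
  moreover have "f t = 0" if "t \<in> T" for t
    using f_add[OF zero(1) that] by simp
  ultimately show ?C by blast
next
  assume C: ?C
  have dec: "r = f r + (r - f r)" for r
    by simp
  have "{s + t | s t. s \<in> S \<and> t \<in> T} = UNIV"
    using C dec by blast
  moreover have "S \<inter> T = {0}"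
  proof -
    have "u = 0" if "u \<in> S" "u \<in> T" for u
      using C that by metis
    then show ?thesis using zero by blast
  qed
  ultimately have dd: "direct_decomposition S T"
    by (simp add: direct_decomposition_def)
  have "rho S T r = f r" for r
  proof -
    have "rho S T (f r + (r - f r)) = f r"
      by (rule rho_add[OF dd S T]) (use C in blast)+
    then show ?thesis by simp
  qed
  then show "equals_rho f S T"
    using dd by (auto simp: equals_rho_def)
qed

lemma inverses_12_sym: "x \<in> inverses_12 a \<longleftrightarrow> a \<in> inverses_12 x"
  by (auto simp: inverses_12_def)

lemma inverses_12_iff_left_mult_projection:
  fixes a x :: "'a::ring_1"
  shows "x \<in> inverses_12 a \<longleftrightarrow>
    equals_rho (left_mult (a * x)) (right_ideal_of a) (rann x)"
proof -
  have "equals_rho (left_mult (a * x)) (right_ideal_of a) (rann x) \<longleftrightarrow>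
      (\<forall>r. left_mult (a * x) r \<in> right_ideal_of a) \<and>
      (\<forall>r. r - left_mult (a * x) r \<in> rann x) \<and>
      (\<forall>s\<in>right_ideal_of a. left_mult (a * x) s = s) \<and>
      (\<forall>t\<in>rann x. left_mult (a * x) t = 0)"
  proof (rule equals_rho_iff)
    show "0 \<in> right_ideal_of a"
      unfolding right_ideal_of_def by simp (metis mult_zero_right)
    show "u - v \<in> right_ideal_of a" if "u \<in> right_ideal_of a" "v \<in> right_ideal_of a" for u v
      using that unfolding right_ideal_of_def by (auto simp: right_diff_distrib[symmetric])
  qed (auto simp: rann_def right_diff_distrib)
  also have "\<dots> \<longleftrightarrow> (\<forall>r. x * r = x * a * x * r) \<and> (\<forall>r. a * x * a * r = a * r)"
    by (auto simp: left_mult_def right_ideal_of_def rann_def right_diff_distrib mult.assoc)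
  also have "\<dots> \<longleftrightarrow> x \<in> inverses_12 a"
    unfolding inverses_12_def by simp (metis mult_1_right)
  finally show ?thesis by simp
qed

lemma inverses_12_iff_right_mult_projection:
  fixes a x :: "'a::ring_1"
  shows "x \<in> inverses_12 a \<longleftrightarrow>
    equals_rho (right_mult (a * x)) (left_ideal_of x) (lann a)"
proof -
  have "equals_rho (right_mult (a * x)) (left_ideal_of x) (lann a) \<longleftrightarrow>
      (\<forall>r. right_mult (a * x) r \<in> left_ideal_of x) \<and>
      (\<forall>r. r - right_mult (a * x) r \<in> lann a) \<and>
      (\<forall>s\<in>left_ideal_of x. right_mult (a * x) s = s) \<and>
      (\<forall>t\<in>lann a. right_mult (a * x) t = 0)"
  proof (rule equals_rho_iff)
    show "0 \<in> left_ideal_of x"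
      unfolding left_ideal_of_def by simp (metis mult_zero_left)
    show "u - v \<in> left_ideal_of x" if "u \<in> left_ideal_of x" "v \<in> left_ideal_of x" for u v
      using that unfolding left_ideal_of_def by (auto simp: left_diff_distrib[symmetric])
  qed (auto simp: lann_def left_diff_distrib)
  also have "\<dots> \<longleftrightarrow> (\<forall>r. r * a = r * (a * x * a)) \<and> (\<forall>r. r * (x * a * x) = r * x)"
    by (auto simp: right_mult_def left_ideal_of_def lann_def left_diff_distrib
        mult.assoc[symmetric])
  also have "\<dots> \<longleftrightarrow> x \<in> inverses_12 a"
    unfolding inverses_12_def by simp (metis mult_1_left)
  finally show ?thesis by simp
qed

theorem theorem3p4:
  fixes a x :: "'a::ring_1"
  shows "(x \<in> inverses_12 a \<longleftrightarrow> equals_rho (left_mult (a * x)) (right_ideal_of a) (rann x))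
    \<and> (x \<in> inverses_12 a \<longleftrightarrow> equals_rho (left_mult (x * a)) (right_ideal_of x) (rann a))
    \<and> (x \<in> inverses_12 a \<longleftrightarrow> equals_rho (right_mult (a * x)) (left_ideal_of x) (lann a))
    \<and> (x \<in> inverses_12 a \<longleftrightarrow> equals_rho (right_mult (x * a)) (left_ideal_of a) (lann x))"
  using inverses_12_iff_left_mult_projection[of x a] inverses_12_iff_left_mult_projection[of a x]
    inverses_12_iff_right_mult_projection[of x a] inverses_12_iff_right_mult_projection[of a x]
    inverses_12_sym[of x a]
  by blast

end
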